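(* There is a universal constant $C<\infty$ with the following property. Let $J_1=(-1,1)$, $T\in(0,\infty]$, $1<p<\infty$, and let $u\in C^\infty_{\mathrm{loc}}(J_1\times[0,T))$ be a Graphical Curve Shortening Flow starting from $u_0:=u(\cdot,0)\in L^p(J_1)$. Then $$|u(0,t)|\le C\left(1+\frac{\|u_0\|_{L^p(J_1)}^{p/(p-1)}}{t^{1/(p-1)}}+t\right)$$ for all $t\in(0,T)$. (Universal means that $C$ is independent of $p$ and $u$.)
   Context: For an interval $J\subseteq\mathbb{R}$, a Graphical Curve Shortening Flow (GCSF) is a smooth real-valued function $u$ of $(x,t)\in J\times(0,T)$ satisfying $\partial_t u=\dfrac{\partial_x^2u}{1+(\partial_xu)^2}=\partial_x[\tan^{-1}(\partial_xu)]$. The notation $u\in C^\infty_{\mathrm{loc}}(J_1\times[0,T))$ means that $u$ is smooth on $J_1\times[0,T)$, including up to the initial time $t=0$ (locally in $J_1$; no boundedness or regularity is assumed at $x=\pm1$). *)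

theory Defs
  imports "HOL-Analysis.Analysis"
begin

text \<open>
  A function of space and time is curried, \<open>u x t\<close>. Partial derivatives are taken within the
  space domain \<open>J\<close> and the time domain \<open>I\<close>, hence are one-sided at endpoints belonging to the
  domain, such as the initial time. They are meaningful when \<open>J\<close> and \<open>I\<close> are nondegenerate
  intervals.
\<close>

definition deriv_x :: "real set \<Rightarrow> (real \<Rightarrow> real \<Rightarrow> real) \<Rightarrow> real \<Rightarrow> real \<Rightarrow> real" where
  "deriv_x J u x t = vector_derivative (\<lambda>y. u y t) (at x within J)"

definition deriv_t :: "real set \<Rightarrow> (real \<Rightarrow> real \<Rightarrow> real) \<Rightarrow> real \<Rightarrow> real \<Rightarrow> real" where
  "deriv_t I u x t = vector_derivative (u x) (at t within I)"

primrec Ck_on :: "nat \<Rightarrow> real set \<Rightarrow> real set \<Rightarrow> (real \<Rightarrow> real \<Rightarrow> real) \<Rightarrow> bool" where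
  "Ck_on 0 J I u \<longleftrightarrow> continuous_on (J \<times> I) (\<lambda>(x, t). u x t)"
| "Ck_on (Suc k) J I u \<longleftrightarrow>
     continuous_on (J \<times> I) (\<lambda>(x, t). u x t) \<and>
     (\<forall>x\<in>J. \<forall>t\<in>I. (\<lambda>y. u y t) differentiable (at x within J) \<and>
                  u x differentiable (at t within I)) \<and>
     Ck_on k J I (deriv_x J u) \<and> Ck_on k J I (deriv_t I u)"

definition smooth_on :: "real set \<Rightarrow> real set \<Rightarrow> (real \<Rightarrow> real \<Rightarrow> real) \<Rightarrow> bool" where
  "smooth_on J I u \<longleftrightarrow> (\<forall>k. Ck_on k J I u)"

text \<open>The time intervals \<open>(0,T)\<close> and \<open>[0,T)\<close>, where \<open>T = \<infinity>\<close> is allowed.\<close>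

definition times_pos :: "ereal \<Rightarrow> real set" where
  "times_pos T = {t. 0 < t \<and> ereal t < T}"

definition times_nonneg :: "ereal \<Rightarrow> real set" where
  "times_nonneg T = {t. 0 \<le> t \<and> ereal t < T}"

text \<open>Graphical Curve Shortening Flow on \<open>J \<times> (0,T)\<close>.\<close>

definition gcsf :: "real set \<Rightarrow> ereal \<Rightarrow> (real \<Rightarrow> real \<Rightarrow> real) \<Rightarrow> bool" where
  "gcsf J T u \<longleftrightarrow>
     is_interval J \<and> smooth_on J (times_pos T) u \<and>
     (\<forall>x\<in>J. \<forall>t\<in>times_pos T.
        deriv_t (times_pos T) u x t = deriv_x J (deriv_x J u) x t / (1 + (deriv_x J u x t)\<^sup>2))"

definition Lp_on :: "real \<Rightarrow> real set \<Rightarrow> (real \<Rightarrow> real) \<Rightarrow> bool" where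
  "Lp_on p J f \<longleftrightarrow>
     f \<in> borel_measurable (lebesgue_on J) \<and> integrable (lebesgue_on J) (\<lambda>x. \<bar>f x\<bar> powr p)"

definition Lp_norm_on :: "real \<Rightarrow> real set \<Rightarrow> (real \<Rightarrow> real) \<Rightarrow> real" where
  "Lp_norm_on p J f = (integral\<^sup>L (lebesgue_on J) (\<lambda>x. \<bar>f x\<bar> powr p)) powr (1 / p)"

end

theory Submission
  imports Defs
begin

text \<open>
  The equation is a conservation law, \<open>u\<^sub>t = (arctan u\<^sub>x)\<^sub>x\<close>, whose flux is bounded by \<open>pi / 2\<close>. A tall
  spike is steep on both sides, so it loses mass at a rate close to \<open>pi\<close>, and it cannot survive
  for longer than its mass divided by this rate. The proof makes this quantitative using only that
  the loss rate exceeds 1.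

  Let the part of \<open>u\<^sub>0\<close> above 0 have mass at most \<open>t\<close>. Suppose that \<open>u(0,t)\<close> exceeds a large multiple
  of \<open>1 + t\<close>. Comparison with a grim reaper, which is infinite at the ends of a short interval around
  0, shows that \<open>u\<close> has a high peak in that interval at every earlier time,
  whatever \<open>u\<close> does near \<open>x = \<plusminus> 1\<close> (\<open>grim_reaper_barrier\<close>). Consider the mass of \<open>F(u)\<close>
  against a cutoff, where \<open>F\<close> is a convex smoothing of the positive part at a scale \<open>m\<close> comparable to
  \<open>1 + t\<close>. Its time derivative consists of the dissipation \<open>- F''(u) u\<^sub>x arctan u\<^sub>x\<close> and of an influx
  through the edge of the cutoff (\<open>excess_mass_rate\<close>). Because \<open>s arctan s \<ge> pi/2 \<bar>s\<bar> - 1\<close>, the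
  dissipation is bounded below by \<open>pi/2\<close> times the variation of \<open>F'(u)\<close>, up to an error of order
  \<open>1/m\<close>. A peak makes this variation close to 1 on its right side alone. The influx is carried only
  by points where \<open>u\<close> is comparable to \<open>m\<close> or larger, of which there are few as the total mass is of
  order \<open>1 + t\<close>. Hence the mass of \<open>F(u)\<close> decreases at a rate greater than 1
  (\<open>excess_mass_decay\<close>). It starts with a value at most \<open>t\<close> and is never negative, a contradiction at time \<open>t\<close>
  (\<open>mass_bound_imp_height_bound\<close>).

  The statement for \<open>u\<^sub>0\<close> in \<open>L\<^sup>p\<close> follows by subtracting a constant \<open>k\<close>. The part of \<open>u\<^sub>0\<close> above \<open>k\<close>
  has mass at most \<open>k\<close> to the power \<open>1 - p\<close> times \<open>\<integral> \<bar>u\<^sub>0\<bar>\<^sup>p\<close>, which is at most \<open>t\<close> exactly when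
  \<open>k\<close> is at least the middle term of the asserted bound. The lower bound on \<open>u(0,t)\<close> is the upper
  bound for \<open>-u\<close>.
\<close>

section \<open>Truncated excess and cutoff\<close>

text \<open>
  A twice continuously differentiable substitute for \<open>z \<mapsto> max 0 z\<close>, smoothed at scale \<open>m\<close>, with
  first and second derivatives \<open>excess1\<close> and \<open>excess2\<close>. Three features matter: it never exceeds
  \<open>max 0 z\<close>; its slope stays in \<open>[0,1]\<close> and climbs almost all the way from 0 to 1 while \<open>z\<close>
  climbs from \<open>m / 10\<close> to \<open>10 * m\<close>; and its second derivative is at most \<open>1 / m\<close>.
\<close>

definition excess :: "real \<Rightarrow> real \<Rightarrow> real" where
  "excess m z = max 0 z - m * arctan (max 0 z / m)"

definition excess1 :: "real \<Rightarrow> real \<Rightarrow> real" where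
  "excess1 m z = (max 0 z)\<^sup>2 / ((max 0 z)\<^sup>2 + m\<^sup>2)"

definition excess2 :: "real \<Rightarrow> real \<Rightarrow> real" where
  "excess2 m z = 2 * max 0 z * m\<^sup>2 / ((max 0 z)\<^sup>2 + m\<^sup>2)\<^sup>2"

text \<open>
  Both derivative formulas below come from this one: composing with the positive part creates no
  kink at 0 when \<open>G\<close> vanishes there to first order.
\<close>

lemma DERIV_comp_positive_part:
  fixes G G' :: "real \<Rightarrow> real"
  assumes der: "\<And>z. 0 \<le> z \<Longrightarrow> (G has_real_derivative G' z) (at z)"
    and "G 0 = 0" "G' 0 = 0"
  shows "((\<lambda>z. G (max 0 z)) has_real_derivative G' (max 0 z)) (at z)"
proof (cases z "0::real" rule: linorder_cases)
  case less
  have "((\<lambda>z. 0) has_real_derivative G' (max 0 z)) (at z)"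
    using less assms by simp
  then show ?thesis
    by (rule has_field_derivative_transform_within_open[where S = "{..<0}"])
      (use less assms in auto)
next
  case equal
  have "((\<lambda>h. G h / h) \<longlongrightarrow> 0) (at 0)"
    using der[of 0] assms by (simp add: DERIV_def)
  then have lim: "((\<lambda>h. \<bar>G h / h\<bar>) \<longlongrightarrow> 0) (at 0)"
    by (rule tendsto_rabs_zero)
  have "((\<lambda>h. G (max 0 h) / h) \<longlongrightarrow> 0) (at 0)"
    by (rule Lim_null_comparison[OF _ lim])
      (auto simp: max_def assms intro!: always_eventually divide_nonneg_nonpos)
  then show ?thesis
    using equal assms by (simp add: DERIV_def)
next
  case greater
  have "(G has_real_derivative G' (max 0 z)) (at z)"
    using der[of z] greater by (simp add: max_def)
  then show ?thesis
    by (rule has_field_derivative_transform_within_open[where S = "{0<..}"])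
      (use greater in auto)
qed

lemma DERIV_excess:
  assumes "0 < m"
  shows "(excess m has_real_derivative excess1 m z) (at z)"
proof -
  have "((\<lambda>z. (\<lambda>p. p - m * arctan (p / m)) (max 0 z)) has_real_derivative
         (\<lambda>p. p\<^sup>2 / (p\<^sup>2 + m\<^sup>2)) (max 0 z)) (at z)"
  proof (rule DERIV_comp_positive_part)
    fix p :: real
    have "p\<^sup>2 + m\<^sup>2 \<noteq> 0" "m\<^sup>2 + p\<^sup>2 \<noteq> 0"
      using assms by (simp_all add: add_nonneg_eq_0_iff)
    then show "((\<lambda>p. p - m * arctan (p / m)) has_real_derivative p\<^sup>2 / (p\<^sup>2 + m\<^sup>2)) (at p)"
      using assms
      by (auto intro!: derivative_eq_intros simp: field_simps power2_eq_square)
  qed auto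
  then show ?thesis
    by (simp add: excess_def[abs_def] excess1_def)
qed

lemma DERIV_excess1:
  assumes "0 < m"
  shows "(excess1 m has_real_derivative excess2 m z) (at z)"
proof -
  have "((\<lambda>z. (\<lambda>p. p\<^sup>2 / (p\<^sup>2 + m\<^sup>2)) (max 0 z)) has_real_derivative
         (\<lambda>p. 2 * p * m\<^sup>2 / (p\<^sup>2 + m\<^sup>2)\<^sup>2) (max 0 z)) (at z)"
  proof (rule DERIV_comp_positive_part)
    fix p :: real
    have "p\<^sup>2 + m\<^sup>2 \<noteq> 0"
      using assms by (simp add: add_nonneg_eq_0_iff)
    then show "((\<lambda>p. p\<^sup>2 / (p\<^sup>2 + m\<^sup>2)) has_real_derivative 2 * p * m\<^sup>2 / (p\<^sup>2 + m\<^sup>2)\<^sup>2) (at p)"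
      by (auto intro!: derivative_eq_intros simp: divide_simps)
        (simp_all add: algebra_simps power2_eq_square)
  qed auto
  then show ?thesis
    by (simp add: excess1_def[abs_def] excess2_def)
qed

lemma continuous_on_excess:
  assumes "0 < m"
  shows "continuous_on S (excess m)" "continuous_on S (excess1 m)" "continuous_on S (excess2 m)"
proof -
  show "continuous_on S (excess m)"
    using DERIV_excess[OF assms] by (meson DERIV_isCont continuous_at_imp_continuous_on)
  show "continuous_on S (excess1 m)"
    using DERIV_excess1[OF assms] by (meson DERIV_isCont continuous_at_imp_continuous_on)
  have "(max 0 z)\<^sup>2 + m\<^sup>2 \<noteq> 0" for z
    using assms by (simp add: add_nonneg_eq_0_iff)
  then show "continuous_on S (excess2 m)"
    unfolding excess2_def[abs_def] by (intro continuous_intros) auto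
qed

lemma arctan_le_self: "0 \<le> x \<Longrightarrow> arctan x \<le> x"
  using abs_arctan_le[of x] by simp

lemma excess_bounds:
  assumes "0 < m"
  shows "0 \<le> excess m z" "excess m z \<le> max 0 z" "max 0 z \<le> excess m z + 2 * m"
proof -
  show "0 \<le> excess m z"
    using mult_left_mono[OF arctan_le_self[of "max 0 z / m"], of m] assms
    by (simp add: excess_def)
  show "excess m z \<le> max 0 z"
    using assms by (simp add: excess_def)
  have "arctan (max 0 z / m) \<le> 2"
    using arctan_ubound[of "max 0 z / m"] pi_less_4 by linarith
  then show "max 0 z \<le> excess m z + 2 * m"
    using mult_left_mono[of "arctan (max 0 z / m)" 2 m] assms unfolding excess_def by linarith
qed

lemma excess1_bounds:
  assumes "0 < m"
  shows "0 \<le> excess1 m z" "excess1 m z \<le> 1" "excess1 m z \<le> max 0 z / (2 * m)"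
proof -
  have pos: "0 < (max 0 z)\<^sup>2 + m\<^sup>2"
    using assms by (simp add: add_nonneg_pos)
  show "0 \<le> excess1 m z" "excess1 m z \<le> 1"
    using pos by (auto simp: excess1_def divide_le_eq_1)
  have "2 * m * max 0 z \<le> (max 0 z)\<^sup>2 + m\<^sup>2"
    using zero_le_power2[of "max 0 z - m"] by (simp add: power2_eq_square algebra_simps)
  then have "(2 * m * max 0 z) * max 0 z \<le> ((max 0 z)\<^sup>2 + m\<^sup>2) * max 0 z"
    by (intro mult_right_mono) auto
  then show "excess1 m z \<le> max 0 z / (2 * m)"
    using pos assms by (simp add: excess1_def divide_simps power2_eq_square algebra_simps)
qed

lemma excess1_large:
  assumes "0 < m" "10 * m \<le> z"
  shows "100 / 101 \<le> excess1 m z"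
proof -
  have "(10 * m)\<^sup>2 \<le> z\<^sup>2"
    using assms by (intro power_mono) auto
  moreover have "0 < z\<^sup>2 + m\<^sup>2"
    using assms by (simp add: add_nonneg_pos)
  ultimately show ?thesis
    using assms by (simp add: excess1_def max_def divide_simps power_mult_distrib)
qed

lemma excess2_bounds:
  assumes "0 < m"
  shows "0 \<le> excess2 m z" "excess2 m z \<le> 1 / m"
proof -
  let ?p = "max 0 z"
  have pos: "0 < ?p\<^sup>2 + m\<^sup>2"
    using assms by (simp add: add_nonneg_pos)
  show "0 \<le> excess2 m z"
    by (simp add: excess2_def)
  have "2 * m * ?p \<le> ?p\<^sup>2 + m\<^sup>2"
    using zero_le_power2[of "?p - m"] by (simp add: power2_eq_square algebra_simps)
  then have "(2 * m * ?p) * m\<^sup>2 \<le> (?p\<^sup>2 + m\<^sup>2) * (?p\<^sup>2 + m\<^sup>2)"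
    by (intro mult_mono) auto
  then have "2 * ?p * m\<^sup>2 * m \<le> (?p\<^sup>2 + m\<^sup>2)\<^sup>2"
    by (simp add: power2_eq_square mult_ac)
  then show "excess2 m z \<le> 1 / m"
    using pos assms by (simp add: excess2_def divide_simps)
qed

text \<open>
  The flux \<open>arctan s\<close> is within \<open>1 / \<bar>s\<bar>\<close> of its limit \<open>\<plusminus> pi / 2\<close>, so a profile that falls through a
  height \<open>h\<close> over a length \<open>L\<close> has \<open>\<integral> s * arctan s\<close> at least \<open>pi / 2 * h - L\<close>, however steep it is.
\<close>

lemma mult_arctan_lower:
  fixes s :: real
  shows "pi / 2 * \<bar>s\<bar> - 1 \<le> s * arctan s"
proof -
  have *: "pi / 2 * x - 1 \<le> x * arctan x" if "0 < x" for x :: real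
  proof -
    have "pi / 2 - arctan x \<le> 1 / x"
      using arctan_inverse[of x] arctan_le_self[of "1 / x"] that by (simp add: inverse_eq_divide)
    then have "x * (pi / 2 - arctan x) \<le> x * (1 / x)"
      using that by (intro mult_left_mono) auto
    then show ?thesis
      using that by (simp add: algebra_simps)
  qed
  show ?thesis
    using *[of s] *[of "- s"] by (cases s "0::real" rule: linorder_cases) (auto simp: arctan_minus)
qed

text \<open>
  The cutoff is a square so that its slope is controlled by its square root, hence by
  \<open>\<epsilon> + bump / (4 * \<epsilon>)\<close>. This lets the weighted mass itself bound the influx through the region where
  the cutoff varies.
\<close>

definition bump :: "real \<Rightarrow> real" where
  "bump x = (1 - 4 * x\<^sup>2)\<^sup>2"

definition bump1 :: "real \<Rightarrow> real" where
  "bump1 x = - 16 * x * (1 - 4 * x\<^sup>2)"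

lemma DERIV_bump: "(bump has_real_derivative bump1 x) (at x)"
  unfolding bump_def[abs_def] bump1_def
  by (auto intro!: derivative_eq_intros simp: power2_eq_square algebra_simps)

lemma continuous_on_bump: "continuous_on S bump" "continuous_on S bump1"
  unfolding bump_def[abs_def] bump1_def[abs_def] by (intro continuous_intros)+

lemma bump_bounds:
  assumes "x \<in> {-1/2..1/2}"
  shows "0 \<le> bump x" "bump x \<le> 1"
    and "0 < \<epsilon> \<Longrightarrow> \<bar>bump1 x\<bar> \<le> 8 * (\<epsilon> + bump x / (4 * \<epsilon>))"
    and "\<bar>bump1 x\<bar> \<le> 8"
proof -
  have "\<bar>x\<bar> \<le> 1/2"
    using assms by auto
  then have "x\<^sup>2 \<le> (1/2)\<^sup>2"
    using power_mono[of "\<bar>x\<bar>" "1/2" 2] by simp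
  then have 1: "0 \<le> 1 - 4 * x\<^sup>2" "1 - 4 * x\<^sup>2 \<le> 1"
    by (simp_all add: power2_eq_square)
  then show "0 \<le> bump x" "bump x \<le> 1"
    by (auto simp: bump_def power_le_one)
  have 2: "\<bar>bump1 x\<bar> \<le> 8 * (1 - 4 * x\<^sup>2)"
    using 1 \<open>\<bar>x\<bar> \<le> 1/2\<close> mult_right_mono[of "16 * \<bar>x\<bar>" 8 "1 - 4 * x\<^sup>2"]
    by (simp add: bump1_def abs_mult)
  then show "\<bar>bump1 x\<bar> \<le> 8"
    by (rule order_trans) (use 1 in simp)
  assume "0 < \<epsilon>"
  have "4 * \<epsilon> * (1 - 4 * x\<^sup>2) \<le> 4 * \<epsilon> * \<epsilon> + bump x"
    using zero_le_power2[of "2 * \<epsilon> - (1 - 4 * x\<^sup>2)"]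
    by (simp add: bump_def power2_eq_square algebra_simps)
  then have "1 - 4 * x\<^sup>2 \<le> \<epsilon> + bump x / (4 * \<epsilon>)"
    using \<open>0 < \<epsilon>\<close> by (simp add: field_simps)
  then show "\<bar>bump1 x\<bar> \<le> 8 * (\<epsilon> + bump x / (4 * \<epsilon>))"
    by (intro order_trans[OF 2] mult_left_mono) auto
qed

lemma bump_central:
  assumes "\<bar>x\<bar> \<le> 1/8"
  shows "87 / 100 \<le> bump x"
proof -
  have "x\<^sup>2 \<le> (1/8)\<^sup>2"
    using power_mono[of "\<bar>x\<bar>" "1/8" 2] assms by simp
  then have "15/16 \<le> 1 - 4 * x\<^sup>2"
    by (simp add: power2_eq_square)
  then have "(15/16)\<^sup>2 \<le> bump x"
    unfolding bump_def by (intro power_mono) auto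
  then show ?thesis
    by (simp add: power2_eq_square)
qed

section \<open>The localized excess mass of a flow\<close>

lemma linear_growth_bound:
  fixes f f' :: "real \<Rightarrow> real"
  assumes "0 \<le> s" "s \<le> \<tau>"
    and der: "\<And>\<sigma>. \<sigma> \<in> {0..\<tau>} \<Longrightarrow> (f has_real_derivative f' \<sigma>) (at \<sigma> within {0..\<tau>})"
    and le: "\<And>\<sigma>. 0 < \<sigma> \<Longrightarrow> \<sigma> < \<tau> \<Longrightarrow> f' \<sigma> \<le> K"
  shows "f s \<le> f 0 + K * s"
proof -
  have "(\<lambda>\<sigma>. f \<sigma> - K * \<sigma>) s \<le> (\<lambda>\<sigma>. f \<sigma> - K * \<sigma>) 0"
  proof (rule DERIV_nonpos_imp_decreasing_open[OF assms(1)])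
    fix \<sigma> assume \<sigma>: "0 < \<sigma>" "\<sigma> < s"
    then have "(f has_real_derivative f' \<sigma>) (at \<sigma>)"
      using der[of \<sigma>] at_within_Icc_at[of 0 \<sigma> \<tau>] assms(2) by simp
    then have "((\<lambda>\<sigma>. f \<sigma> - K * \<sigma>) has_real_derivative f' \<sigma> - K) (at \<sigma>)"
      by (auto intro!: derivative_eq_intros)
    then show "\<exists>y. ((\<lambda>\<sigma>. f \<sigma> - K * \<sigma>) has_real_derivative y) (at \<sigma>) \<and> y \<le> 0"
      using le[of \<sigma>] \<sigma> assms(2) by fastforce
  next
    have "continuous_on {0..\<tau>} f"
      by (rule DERIV_continuous_on[OF der])
    then have "continuous_on {0..s} f"
      by (rule continuous_on_subset) (use assms in auto)
    then show "continuous_on {0..s} (\<lambda>\<sigma>. f \<sigma> - K * \<sigma>)"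
      by (intro continuous_intros)
  qed
  then show ?thesis
    by simp
qed

text \<open>
  The form of the flow on \<open>(-1,1) \<times> [0,\<tau>]\<close> that the estimates use: \<open>p\<close> and \<open>q\<close> are the first two
  space derivatives of \<open>u\<close> and \<open>r\<close> is its time derivative. Unlike the full smoothness hypothesis,
  these conditions pass to \<open>-u\<close> and \<open>u - k\<close> immediately.
\<close>

locale classical_flow =
  fixes \<tau> :: real and u p q r :: "real \<Rightarrow> real \<Rightarrow> real"
  assumes duration: "0 < \<tau>"
    and continuous_u: "continuous_on ({-1<..<1} \<times> {0..\<tau>}) (\<lambda>(x, s). u x s)"
    and continuous_p: "continuous_on ({-1<..<1} \<times> {0..\<tau>}) (\<lambda>(x, s). p x s)"
    and continuous_r: "continuous_on ({-1<..<1} \<times> {0..\<tau>}) (\<lambda>(x, s). r x s)"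
    and DERIV_u: "\<And>x s. x \<in> {-1<..<1} \<Longrightarrow> s \<in> {0..\<tau>} \<Longrightarrow>
          ((\<lambda>y. u y s) has_real_derivative p x s) (at x)"
    and DERIV_p: "\<And>x s. x \<in> {-1<..<1} \<Longrightarrow> s \<in> {0..\<tau>} \<Longrightarrow>
          ((\<lambda>y. p y s) has_real_derivative q x s) (at x)"
    and DERIV_time: "\<And>x s. x \<in> {-1<..<1} \<Longrightarrow> s \<in> {0..\<tau>} \<Longrightarrow>
          (u x has_real_derivative r x s) (at s within {0..\<tau>})"
    and flow: "\<And>x s. x \<in> {-1<..<1} \<Longrightarrow> 0 < s \<Longrightarrow> s \<le> \<tau> \<Longrightarrow>
          r x s = q x s / (1 + (p x s)\<^sup>2)"
begin

lemma continuous_on_flow: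
  assumes "continuous_on A f" "continuous_on A g"
    and "\<And>a. a \<in> A \<Longrightarrow> f a \<in> {-1<..<1} \<and> g a \<in> {0..\<tau>}"
  shows "continuous_on A (\<lambda>a. u (f a) (g a))" "continuous_on A (\<lambda>a. p (f a) (g a))"
    "continuous_on A (\<lambda>a. r (f a) (g a))"
proof -
  have pair: "continuous_on A (\<lambda>a. (f a, g a))"
    using assms by (intro continuous_intros)
  have sub: "(\<lambda>a. (f a, g a)) ` A \<subseteq> {-1<..<1} \<times> {0..\<tau>}"
    using assms(3) by auto
  show "continuous_on A (\<lambda>a. u (f a) (g a))"
    using continuous_on_compose2[OF continuous_u pair sub] by simp
  show "continuous_on A (\<lambda>a. p (f a) (g a))"
    using continuous_on_compose2[OF continuous_p pair sub] by simp
  show "continuous_on A (\<lambda>a. r (f a) (g a))"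
    using continuous_on_compose2[OF continuous_r pair sub] by simp
qed

lemma continuous_on_excess_flow:
  assumes "0 < m" "continuous_on A f" "continuous_on A g"
    and "\<And>a. a \<in> A \<Longrightarrow> f a \<in> {-1<..<1} \<and> g a \<in> {0..\<tau>}"
  shows "continuous_on A (\<lambda>a. excess m (u (f a) (g a)))"
    "continuous_on A (\<lambda>a. excess1 m (u (f a) (g a)))"
    "continuous_on A (\<lambda>a. excess2 m (u (f a) (g a)))"
  using continuous_on_compose2[OF continuous_on_excess(1)[OF assms(1), of UNIV]
      continuous_on_flow(1)[OF assms(2-4)]]
    continuous_on_compose2[OF continuous_on_excess(2)[OF assms(1), of UNIV]
      continuous_on_flow(1)[OF assms(2-4)]]
    continuous_on_compose2[OF continuous_on_excess(3)[OF assms(1), of UNIV]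
      continuous_on_flow(1)[OF assms(2-4)]]
  by simp_all

lemma continuous_on_slice:
  assumes "s \<in> {0..\<tau>}" "A \<subseteq> {-1/2..1/2}"
  shows "continuous_on A (\<lambda>x. u x s)" "continuous_on A (\<lambda>x. p x s)"
    "continuous_on A (\<lambda>x. r x s)"
    and "0 < m \<Longrightarrow> continuous_on A (\<lambda>x. excess m (u x s))"
    and "0 < m \<Longrightarrow> continuous_on A (\<lambda>x. excess1 m (u x s))"
    and "0 < m \<Longrightarrow> continuous_on A (\<lambda>x. excess2 m (u x s))"
proof -
  have sub: "\<And>a. a \<in> A \<Longrightarrow> a \<in> {-1<..<1} \<and> s \<in> {0..\<tau>}"
    using assms by fastforce
  show "continuous_on A (\<lambda>x. u x s)" "continuous_on A (\<lambda>x. p x s)"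
    "continuous_on A (\<lambda>x. r x s)"
    using continuous_on_flow[OF continuous_on_id continuous_on_const sub] by simp_all
  show "0 < m \<Longrightarrow> continuous_on A (\<lambda>x. excess m (u x s))"
    "0 < m \<Longrightarrow> continuous_on A (\<lambda>x. excess1 m (u x s))"
    "0 < m \<Longrightarrow> continuous_on A (\<lambda>x. excess2 m (u x s))"
    using continuous_on_excess_flow[OF _ continuous_on_id continuous_on_const sub] by simp_all
qed

lemmas slice_intros =
  continuous_on_slice continuous_on_bump continuous_intros

definition excess_mass :: "real \<Rightarrow> real \<Rightarrow> real" where
  "excess_mass m s = integral {-1/2..1/2} (\<lambda>x. bump x * excess m (u x s))"

definition positive_mass :: "real \<Rightarrow> real" where
  "positive_mass s = integral {-1/2..1/2} (\<lambda>x. bump x * max 0 (u x s))"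

lemma integrable_slice:
  assumes "s \<in> {0..\<tau>}"
  shows "(\<lambda>x. bump x * max 0 (u x s)) integrable_on {-1/2..1/2}"
    and "0 < m \<Longrightarrow> (\<lambda>x. bump x * excess m (u x s)) integrable_on {-1/2..1/2}"
    and "0 < m \<Longrightarrow> (\<lambda>x. bump x * excess1 m (u x s)) integrable_on {-1/2..1/2}"
    and "0 < m \<Longrightarrow> (\<lambda>x. bump x * (excess1 m (u x s) * r x s)) integrable_on {-1/2..1/2}"
    and "0 < m \<Longrightarrow> (\<lambda>x. bump x * (excess2 m (u x s) * p x s * arctan (p x s)))
            integrable_on {-1/2..1/2}"
    and "0 < m \<Longrightarrow> (\<lambda>x. bump1 x * (excess1 m (u x s) * arctan (p x s)))
            integrable_on {-1/2..1/2}"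
  by (rule integrable_continuous_interval; auto intro!: slice_intros assms)+

lemma DERIV_excess_mass:
  assumes "0 < m" "s \<in> {0..\<tau>}"
  shows "(excess_mass m has_real_derivative
      integral {-1/2..1/2} (\<lambda>x. bump x * (excess1 m (u x s) * r x s))) (at s within {0..\<tau>})"
proof -
  have "((\<lambda>s. integral (cbox (-1/2) (1/2)) (\<lambda>x. bump x * excess m (u x s))) has_real_derivative
      integral (cbox (-1/2) (1/2)) (\<lambda>x. bump x * (excess1 m (u x s) * r x s))) (at s within {0..\<tau>})"
  proof (rule leibniz_rule_field_derivative[where fx = "\<lambda>s x. bump x * (excess1 m (u x s) * r x s)"])
    fix \<sigma> x :: real assume \<sigma>: "\<sigma> \<in> {0..\<tau>}" and x: "x \<in> cbox (-1/2) (1/2)"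
    have "x \<in> {-1<..<1}"
      using x by auto
    from DERIV_chain2[OF DERIV_excess[OF assms(1)] DERIV_time[OF this \<sigma>]]
    have "((\<lambda>\<sigma>. excess m (u x \<sigma>)) has_real_derivative excess1 m (u x \<sigma>) * r x \<sigma>)
        (at \<sigma> within {0..\<tau>})" .
    then show "((\<lambda>\<sigma>. bump x * excess m (u x \<sigma>)) has_real_derivative
        bump x * (excess1 m (u x \<sigma>) * r x \<sigma>)) (at \<sigma> within {0..\<tau>})"
      by (rule DERIV_cmult)
  next
    fix \<sigma> assume "\<sigma> \<in> {0..\<tau>}"
    then show "(\<lambda>x. bump x * excess m (u x \<sigma>)) integrable_on cbox (-1/2) (1/2)"
      using integrable_slice(2) assms(1) by simp
  next
    let ?A = "{0..\<tau>} \<times> cbox (-1/2) (1/2::real)"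
    have c: "continuous_on ?A fst" "continuous_on ?A snd"
      by (intro continuous_intros)+
    have sub: "\<And>a. a \<in> ?A \<Longrightarrow> snd a \<in> {-1<..<1} \<and> fst a \<in> {0..\<tau>}"
      by auto
    have "continuous_on ?A (\<lambda>a. bump (snd a) * (excess1 m (u (snd a) (fst a)) * r (snd a) (fst a)))"
      by (intro continuous_on_mult continuous_on_excess_flow(2)[OF assms(1) c(2,1) sub]
          continuous_on_flow(3)[OF c(2,1) sub]
          continuous_on_compose2[OF continuous_on_bump(1)[of UNIV] c(2)]) auto
    then show "continuous_on ?A (\<lambda>(s, x). bump x * (excess1 m (u x s) * r x s))"
      by (simp add: case_prod_unfold)
  qed (use assms in auto)
  then show ?thesis
    unfolding excess_mass_def[abs_def] by simp
qed

text \<open>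
  Integration by parts against the divergence form \<open>r = (arctan p)'\<close>. The first term is the
  dissipation, which has a sign; the second is the flux through the edge of the cutoff. Since
  \<open>arctan\<close> is bounded, the latter is controlled whatever the slope of \<open>u\<close> is there.
\<close>

lemma excess_mass_rate:
  assumes "0 < m" "0 < s" "s \<le> \<tau>"
  shows "integral {-1/2..1/2} (\<lambda>x. bump x * (excess1 m (u x s) * r x s)) =
      - integral {-1/2..1/2} (\<lambda>x. bump x * (excess2 m (u x s) * p x s * arctan (p x s)))
      - integral {-1/2..1/2} (\<lambda>x. bump1 x * (excess1 m (u x s) * arctan (p x s)))"
proof -
  have s: "s \<in> {0..\<tau>}"
    using assms by auto
  let ?Q = "\<lambda>x. bump x * (excess1 m (u x s) * arctan (p x s))"
  let ?Q' = "\<lambda>x. bump x * (excess2 m (u x s) * p x s * arctan (p x s))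
      + bump1 x * (excess1 m (u x s) * arctan (p x s))
      + bump x * (excess1 m (u x s) * r x s)"
  have "(?Q' has_integral ?Q (1/2) - ?Q (-1/2)) {-1/2..1/2}"
  proof (rule fundamental_theorem_of_calculus)
    fix x :: real assume "x \<in> {-1/2..1/2}"
    then have x: "x \<in> {-1<..<1}"
      by auto
    have 1: "((\<lambda>x. excess1 m (u x s)) has_real_derivative excess2 m (u x s) * p x s) (at x)"
      by (rule DERIV_chain2[OF DERIV_excess1[OF assms(1)] DERIV_u[OF x s]])
    have "((\<lambda>x. arctan (p x s)) has_real_derivative inverse (1 + (p x s)\<^sup>2) * q x s) (at x)"
      by (rule DERIV_chain2[OF DERIV_arctan DERIV_p[OF x s]])
    then have 2: "((\<lambda>x. arctan (p x s)) has_real_derivative r x s) (at x)"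
      using flow[OF x assms(2,3)] by (simp add: field_simps)
    have "(?Q has_real_derivative ?Q' x) (at x)"
      by (rule DERIV_cong[OF DERIV_mult[OF DERIV_bump DERIV_mult[OF 1 2]]])
        (simp add: algebra_simps)
    then show "(?Q has_vector_derivative ?Q' x) (at x within {-1/2..1/2})"
      using has_field_derivative_at_within has_real_derivative_iff_has_vector_derivative by blast
  qed auto
  then have "integral {-1/2..1/2} ?Q' = 0"
    by (auto dest!: integral_unique simp: bump_def power2_eq_square)
  moreover have "integral {-1/2..1/2} ?Q' =
      integral {-1/2..1/2} (\<lambda>x. bump x * (excess2 m (u x s) * p x s * arctan (p x s)))
      + integral {-1/2..1/2} (\<lambda>x. bump1 x * (excess1 m (u x s) * arctan (p x s)))
      + integral {-1/2..1/2} (\<lambda>x. bump x * (excess1 m (u x s) * r x s))"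
    using integrable_slice[OF s] assms(1) by (simp add: integral_add integrable_add)
  ultimately show ?thesis
    by linarith
qed

lemma boundary_term_bound:
  assumes "0 < m"
  shows "- (bump1 x * (excess1 m (u x s) * arctan (p x s))) \<le> 2 * \<bar>bump1 x\<bar> * excess1 m (u x s)"
proof -
  have "\<bar>arctan (p x s)\<bar> \<le> 2"
    using arctan_bounded[of "p x s"] pi_less_4 by linarith
  then have "\<bar>bump1 x\<bar> * excess1 m (u x s) * \<bar>arctan (p x s)\<bar> \<le> \<bar>bump1 x\<bar> * excess1 m (u x s) * 2"
    using excess1_bounds[OF assms] by (intro mult_left_mono) auto
  moreover have "- (bump1 x * (excess1 m (u x s) * arctan (p x s)))
      \<le> \<bar>bump1 x * (excess1 m (u x s) * arctan (p x s))\<bar>"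
    by linarith
  ultimately show ?thesis
    using excess1_bounds(1)[OF assms, of "u x s"] by (simp add: abs_mult mult_ac)
qed

lemma bump_dissipation_nonneg:
  assumes "0 < m" "x \<in> {-1/2..1/2}"
  shows "0 \<le> bump x * (excess2 m (u x s) * p x s * arctan (p x s))"
proof -
  have "0 \<le> p x s * arctan (p x s)"
    by (cases "0 \<le> p x s") (auto intro: mult_nonpos_nonpos)
  then show ?thesis
    using excess2_bounds(1)[OF assms(1), of "u x s"] bump_bounds(1)[OF assms(2)]
    by (simp add: mult.assoc)
qed

text \<open>
  Dropping the dissipation leaves only the influx: \<open>\<bar>arctan\<bar> \<le> 2\<close> and \<open>\<bar>bump1\<bar> \<le> 8\<close>.
\<close>

lemma excess_mass_growth:
  assumes "0 < m" "s \<in> {0..\<tau>}"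
  shows "excess_mass m s \<le> excess_mass m 0 + 16 * s"
proof (rule linear_growth_bound[OF _ _ DERIV_excess_mass[OF assms(1)]])
  fix \<sigma> assume \<sigma>: "0 < \<sigma>" "\<sigma> < \<tau>"
  then have \<sigma>': "\<sigma> \<in> {0..\<tau>}"
    by auto
  have "0 \<le> integral {-1/2..1/2} (\<lambda>x. bump x * (excess2 m (u x \<sigma>) * p x \<sigma> * arctan (p x \<sigma>)))"
    using bump_dissipation_nonneg[OF assms(1)]
    by (intro integral_nonneg integrable_slice \<sigma>' assms) auto
  moreover have "integral {-1/2..1/2} (\<lambda>x. - (bump1 x * (excess1 m (u x \<sigma>) * arctan (p x \<sigma>))))
      \<le> integral {-1/2..1/2::real} (\<lambda>x. 16)"
  proof (intro integral_le integrable_neg integrable_slice \<sigma>' assms)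
    fix x :: real assume x: "x \<in> {-1/2..1/2}"
    have "\<bar>bump1 x\<bar> * excess1 m (u x \<sigma>) \<le> 8 * 1"
      using bump_bounds(4)[OF x] excess1_bounds[OF assms(1), of "u x \<sigma>"] by (intro mult_mono) auto
    then show "- (bump1 x * (excess1 m (u x \<sigma>) * arctan (p x \<sigma>))) \<le> 16"
      using boundary_term_bound[OF assms(1), of x \<sigma>] by linarith
  qed auto
  ultimately show "integral {-1/2..1/2} (\<lambda>x. bump x * (excess1 m (u x \<sigma>) * r x \<sigma>)) \<le> 16"
    using excess_mass_rate[OF assms(1), of \<sigma>] \<sigma> by simp
qed (use assms in auto)

lemma excess_mass_le_positive_mass:
  assumes "0 < m" "s \<in> {0..\<tau>}"
  shows "0 \<le> excess_mass m s" "excess_mass m s \<le> positive_mass s"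
    "positive_mass s \<le> excess_mass m s + 2 * m"
proof -
  note int = integrable_slice(1,2)[OF assms(2)] assms(1)
  show "0 \<le> excess_mass m s"
    unfolding excess_mass_def using excess_bounds(1)[OF assms(1)] bump_bounds(1)
    by (intro integral_nonneg int) auto
  show "excess_mass m s \<le> positive_mass s"
    unfolding excess_mass_def positive_mass_def
    using excess_bounds(2)[OF assms(1)] bump_bounds(1)
    by (intro integral_le int mult_left_mono) auto
  have "positive_mass s \<le> integral {-1/2..1/2} (\<lambda>x. bump x * excess m (u x s) + 2 * m)"
    unfolding positive_mass_def
  proof (intro integral_le int integrable_add)
    fix x :: real assume x: "x \<in> {-1/2..1/2}"
    have "bump x * max 0 (u x s) \<le> bump x * (excess m (u x s) + 2 * m)"
      using excess_bounds(3)[OF assms(1)] bump_bounds(1)[OF x] by (intro mult_left_mono) auto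
    moreover have "bump x * (2 * m) \<le> 1 * (2 * m)"
      using bump_bounds(2)[OF x] assms(1) by (intro mult_right_mono) auto
    ultimately show "bump x * max 0 (u x s) \<le> bump x * excess m (u x s) + 2 * m"
      by (simp add: algebra_simps)
  qed auto
  also have "\<dots> = excess_mass m s + 2 * m"
    unfolding excess_mass_def by (subst integral_add) (use int in auto)
  finally show "positive_mass s \<le> excess_mass m s + 2 * m" .
qed

text \<open>
  The growth bound holds for the smoothed mass; smoothing at scale 1 costs a constant, which is
  harmless next to the scale \<open>m\<close> of the main estimate.
\<close>

lemma positive_mass_growth:
  assumes "s \<in> {0..\<tau>}"
  shows "positive_mass s \<le> positive_mass 0 + 16 * s + 2"
  using excess_mass_growth[of 1 s] excess_mass_le_positive_mass[of 1 s]
    excess_mass_le_positive_mass[of 1 0] assms duration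
  by auto

end

section \<open>The grim reaper barrier\<close>

lemma second_derivative_at_max:
  fixes g g' :: "real \<Rightarrow> real"
  assumes "0 < d"
    and max: "\<And>y. \<bar>x - y\<bar> < d \<Longrightarrow> g y \<le> g x"
    and der: "\<And>y. \<bar>x - y\<bar> < d \<Longrightarrow> (g has_real_derivative g' y) (at y)"
    and der2: "(g' has_real_derivative g'') (at x)"
  shows "g' x = 0" "g'' \<le> 0"
proof -
  show zero: "g' x = 0"
    using DERIV_local_max[OF der[of x] \<open>0 < d\<close>] max \<open>0 < d\<close> by simp
  show "g'' \<le> 0"
  proof (rule ccontr)
    assume "\<not> g'' \<le> 0"
    then obtain e where e: "0 < e" "\<And>h. 0 < h \<Longrightarrow> h < e \<Longrightarrow> g' x < g' (x + h)"
      using DERIV_pos_inc_right[OF der2] by auto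
    define h where "h = min d e / 2"
    have h: "0 < h" "h < d" "h < e"
      using \<open>0 < d\<close> \<open>0 < e\<close> by (auto simp: h_def)
    have "g x < g (x + h)"
    proof (rule DERIV_pos_imp_increasing_open[where f = g and a = x and b = "x + h"])
      fix y assume y: "x < y" "y < x + h"
      then have "(g has_real_derivative g' y) (at y)"
        using der[of y] h by simp
      moreover have "0 < g' y"
        using e(2)[of "y - x"] y h zero by simp
      ultimately show "\<exists>l. (g has_real_derivative l) (at y) \<and> 0 < l"
        by blast
    next
      show "continuous_on {x..x + h} g"
        by (rule DERIV_continuous_on[where D = g'], rule has_field_derivative_at_within, rule der)
          (use h in auto)
    qed (use h in simp)
    then show False
      using max[of "x + h"] h by simp
  qed
qed

context classical_flow
begin

text \<open>
  The grim reaper \<open>- ln (cos (l * x)) / l + l * \<sigma>\<close> is a translating solution that is infinite at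
  \<open>x = \<plusminus> a\<close> when \<open>l * a = pi / 2\<close>. It therefore bounds \<open>u\<close> from above on \<open>[-a,a]\<close> whatever the
  boundary values of \<open>u\<close> are. Read backwards, a large value of \<open>u 0 \<tau>\<close> forces a large value somewhere
  in \<open>[-a,a]\<close> at each earlier time.
\<close>

lemma grim_reaper_barrier:
  assumes a: "0 < a" "a < 1" and s: "0 \<le> s" "s \<le> \<tau>"
    and le: "\<And>x. \<bar>x\<bar> \<le> a \<Longrightarrow> u x s \<le> B"
  shows "u 0 \<tau> \<le> B + pi / (2 * a) * (\<tau> - s)"
proof (rule ccontr)
  define l where "l = pi / (2 * a)"
  assume "\<not> ?thesis"
  then have contra: "B + l * (\<tau> - s) < u 0 \<tau>"
    by (simp add: l_def)
  have l: "0 < l" "l * a = pi / 2"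
    using a by (auto simp: l_def)
  have "s \<noteq> \<tau>"
    using contra le[of 0] a by auto
  with s have "s < \<tau>"
    by simp
  \<comment> \<open>Raising the speed by \<open>\<epsilon>\<close> makes the barrier a strict supersolution and still leaves \<open>u 0 \<tau>\<close>
     above it.\<close>
  define \<epsilon> where "\<epsilon> = (u 0 \<tau> - B - l * (\<tau> - s)) / (\<tau> - s) / 2"
  have half: "2 * (c / d / 2 * d) = c" if "d \<noteq> 0" for c d :: real
    using that by simp
  have \<epsilon>: "0 < \<epsilon>" "2 * (\<epsilon> * (\<tau> - s)) = u 0 \<tau> - B - l * (\<tau> - s)"
    unfolding \<epsilon>_def using contra \<open>s < \<tau>\<close> half[of "\<tau> - s"] by auto
  have "continuous_on ({-a..a} \<times> {s..\<tau>}) (\<lambda>z. u (fst z) (snd z))"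
    by (rule continuous_on_flow) (use a s in \<open>auto intro!: continuous_intros\<close>)
  then have "bounded ((\<lambda>z. u (fst z) (snd z)) ` ({-a..a} \<times> {s..\<tau>}))"
    by (intro compact_imp_bounded compact_continuous_image compact_Times) auto
  then obtain S0 where S0: "\<forall>x\<in>{-a..a}. \<forall>\<sigma>\<in>{s..\<tau>}. \<bar>u x \<sigma>\<bar> \<le> S0"
    by (auto simp: bounded_iff)
  define S where "S = max B S0"
  have S: "u x \<sigma> \<le> S" if "\<bar>x\<bar> \<le> a" "s \<le> \<sigma>" "\<sigma> \<le> \<tau>" for x \<sigma>
    using S0[rule_format, of x \<sigma>] that by (auto simp: S_def abs_le_iff)
  define L where "L = l * (S - B + 1)"
  have "0 < L"
    using l by (auto simp: L_def S_def)
  \<comment> \<open>At \<open>\<rho>\<close> the grim reaper reaches the height \<open>S - B + 1\<close>, which lifts the barrier above \<open>u\<close>.\<close>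
  define \<rho> where "\<rho> = arccos (exp (- L)) / l"
  have "0 < arccos (exp (- L))" "arccos (exp (- L)) < pi / 2"
    using arccos_lt_bounded[of "exp (- L)"] arccos_less_mono[of "exp (- L)" 0] \<open>0 < L\<close>
      exp_gt_zero[of "- L"]
    by (auto simp del: exp_gt_zero)
  then have \<rho>: "0 < \<rho>" "l * \<rho> < pi / 2" "cos (l * \<rho>) = exp (- L)"
    using l \<open>0 < L\<close> exp_gt_zero[of "- L"] by (auto simp: \<rho>_def cos_arccos simp del: exp_gt_zero)
  have "l * \<rho> < l * a"
    unfolding l(2) by (rule \<rho>(2))
  then have "\<rho> < a"
    using l(1) by simp
  have angle: "\<bar>l * x\<bar> < pi / 2" if "\<bar>x\<bar> \<le> \<rho>" for x
  proof -
    have "\<bar>l * x\<bar> \<le> l * \<rho>"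
      using that l by (simp add: abs_mult)
    then show ?thesis
      using \<rho> by linarith
  qed
  have cos_pos: "0 < cos (l * x)" if "\<bar>x\<bar> \<le> \<rho>" for x
    using angle[OF that] by (intro cos_gt_zero_pi) auto
  define v where "v = (\<lambda>x \<sigma>. u x \<sigma> - B + ln (cos (l * x)) / l - (l + \<epsilon>) * (\<sigma> - s))"
  define K where "K = {-\<rho>..\<rho>} \<times> {s..\<tau>}"
  have "continuous_on K (\<lambda>z. u (fst z) (snd z))"
    unfolding K_def
    by (rule continuous_on_flow) (use a s \<open>\<rho> < a\<close> in \<open>auto intro!: continuous_intros\<close>)
  moreover have "cos (l * fst z) \<noteq> 0" if "z \<in> K" for z
    using cos_pos[of "fst z"] that by (auto simp: K_def abs_le_iff)
  ultimately have "continuous_on K (\<lambda>z. v (fst z) (snd z))"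
    unfolding v_def using l by (intro continuous_intros) auto
  moreover have "compact K" "(0, \<tau>) \<in> K"
    using \<rho> s by (auto simp: K_def intro: compact_Times)
  ultimately obtain z where "z \<in> K" "\<forall>w\<in>K. v (fst w) (snd w) \<le> v (fst z) (snd z)"
    using continuous_attains_sup[of K "\<lambda>z. v (fst z) (snd z)"] by blast
  then have max: "\<bar>fst z\<bar> \<le> \<rho>" "s \<le> snd z" "snd z \<le> \<tau>"
    "\<forall>y\<in>{-\<rho>..\<rho>}. \<forall>\<theta>\<in>{s..\<tau>}. v y \<theta> \<le> v (fst z) (snd z)"
    by (auto simp: K_def abs_le_iff)
  obtain x \<sigma> where x: "\<bar>x\<bar> \<le> \<rho>" and \<sigma>: "s \<le> \<sigma>" "\<sigma> \<le> \<tau>"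
    and vmax: "\<And>y \<theta>. \<bar>y\<bar> \<le> \<rho> \<Longrightarrow> s \<le> \<theta> \<Longrightarrow> \<theta> \<le> \<tau> \<Longrightarrow> v y \<theta> \<le> v x \<sigma>"
    by (rule that[OF max(1-3)]) (use max(4) in \<open>simp add: abs_le_iff\<close>)
  have "0 < v 0 \<tau>"
    using \<epsilon> \<open>s < \<tau>\<close> contra by (simp add: v_def algebra_simps)
  then have vpos: "0 < v x \<sigma>"
    using vmax[of 0 \<tau>] \<rho> s by simp
  have "ln (cos (l * x)) \<le> 0"
    using cos_pos[OF x] by simp
  then have log_nonpos: "ln (cos (l * x)) / l \<le> 0"
    using l by (simp add: divide_nonpos_pos)
  have "\<sigma> \<noteq> s"
    using vpos log_nonpos le[of x] x \<open>\<rho> < a\<close> by (auto simp: v_def)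
  then have "s < \<sigma>"
    using \<sigma> by simp
  have "\<bar>x\<bar> \<noteq> \<rho>"
  proof
    assume "\<bar>x\<bar> = \<rho>"
    then have "cos (l * x) = exp (- L)"
      using \<rho> by (cases "0 \<le> x") (auto simp: abs_real_def)
    then have "ln (cos (l * x)) / l = - (S - B + 1)"
      using l by (simp add: L_def)
    moreover have "0 \<le> (l + \<epsilon>) * (\<sigma> - s)"
      using l \<epsilon> \<sigma> by simp
    ultimately show False
      using vpos S[of x \<sigma>] x \<sigma> \<open>\<rho> < a\<close> by (simp add: v_def)
  qed
  then have "\<bar>x\<bar> < \<rho>"
    using x by simp
  have xJ: "y \<in> {-1<..<1}" if "\<bar>y\<bar> \<le> \<rho>" for y
    using that \<open>\<rho> < a\<close> a by auto
  have \<sigma>I: "\<sigma> \<in> {0..\<tau>}"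
    using s \<sigma> by simp
  \<comment> \<open>At the maximum the time derivative is one-sided if \<open>\<sigma> = \<tau>\<close>.\<close>
  have time: "l + \<epsilon> \<le> r x \<sigma>"
  proof (rule ccontr)
    assume "\<not> l + \<epsilon> \<le> r x \<sigma>"
    moreover have "((\<lambda>\<theta>. v x \<theta>) has_real_derivative r x \<sigma> - (l + \<epsilon>)) (at \<sigma> within {0..\<tau>})"
      unfolding v_def
      by (rule derivative_eq_intros DERIV_time[OF xJ[OF x] \<sigma>I] refl | simp)+
    ultimately obtain d where d: "0 < d"
      "\<And>h. 0 < h \<Longrightarrow> \<sigma> - h \<in> {0..\<tau>} \<Longrightarrow> h < d \<Longrightarrow> v x \<sigma> < v x (\<sigma> - h)"
      using has_real_derivative_neg_dec_left by (metis diff_less_0_iff_less not_le)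
    define h where "h = min d (\<sigma> - s) / 2"
    have "0 < h" "h < d" "s \<le> \<sigma> - h"
      using d(1) \<open>s < \<sigma>\<close> by (auto simp: h_def min_def field_simps)
    then show False
      using d(2)[of h] vmax[of x "\<sigma> - h"] x s \<sigma> by simp
  qed
  have space: "p x \<sigma> - tan (l * x) = 0" "q x \<sigma> - l * (1 + (tan (l * x))\<^sup>2) \<le> 0"
  proof -
    define g' where "g' = (\<lambda>y. p y \<sigma> - tan (l * y))"
    have d: "0 < \<rho> - \<bar>x\<bar>"
      using \<open>\<bar>x\<bar> < \<rho>\<close> by simp
    have near: "\<bar>y\<bar> \<le> \<rho>" if "\<bar>x - y\<bar> < \<rho> - \<bar>x\<bar>" for y
      using that by linarith
    have 1: "v y \<sigma> \<le> v x \<sigma>" if "\<bar>x - y\<bar> < \<rho> - \<bar>x\<bar>" for y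
      using vmax[OF near[OF that]] \<sigma> by simp
    have 2: "((\<lambda>y. v y \<sigma>) has_real_derivative g' y) (at y)" if "\<bar>x - y\<bar> < \<rho> - \<bar>x\<bar>" for y
      unfolding v_def g'_def using l cos_pos[OF near[OF that]]
      by (auto intro!: derivative_eq_intros DERIV_u[OF xJ[OF near[OF that]] \<sigma>I]
          simp: tan_def field_simps)
    have "((\<lambda>y. tan (l * y)) has_real_derivative inverse ((cos (l * x))\<^sup>2) * l) (at x)"
      using cos_pos[OF x]
      by (intro DERIV_chain2[OF DERIV_tan]) (auto intro!: derivative_eq_intros)
    moreover have "inverse ((cos (l * x))\<^sup>2) = 1 + (tan (l * x))\<^sup>2"
      using tan_sec[of "l * x"] cos_pos[OF x] by (simp add: power_inverse)
    ultimately have "((\<lambda>y. tan (l * y)) has_real_derivative l * (1 + (tan (l * x))\<^sup>2)) (at x)"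
      by (simp add: mult.commute)
    then have 3: "(g' has_real_derivative q x \<sigma> - l * (1 + (tan (l * x))\<^sup>2)) (at x)"
      unfolding g'_def by (intro DERIV_diff DERIV_p xJ x \<sigma>I)
    show "p x \<sigma> - tan (l * x) = 0" "q x \<sigma> - l * (1 + (tan (l * x))\<^sup>2) \<le> 0"
      using second_derivative_at_max[OF d 1 2 3] by (simp_all add: g'_def)
  qed
  have "0 < 1 + (tan (l * x))\<^sup>2"
    by (simp add: add_pos_nonneg)
  then have "r x \<sigma> \<le> l"
    using flow[OF xJ[OF x], of \<sigma>] s \<open>s < \<sigma>\<close> \<sigma> space by (simp add: pos_divide_le_eq)
  then show False
    using time \<epsilon> by simp
qed

end

section \<open>A high peak dissipates mass\<close>

context classical_flow
begin

text \<open>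
  To the right of a peak of height \<open>10 * m\<close> the profile soon drops low, because the mass is small.
  The slope \<open>excess1\<close> then falls by almost 1, and the inequality for \<open>s * arctan s\<close> turns this fall into
  a dissipation of almost \<open>pi / 2\<close>, reduced only by the weight \<open>bump \<ge> 87/100\<close> and an error of order
  \<open>1 / m\<close>. The drop on one side suffices since \<open>pi / 2\<close> exceeds 1 with enough room for
  these losses and for the influx.
\<close>

lemma excess_mass_decay:
  assumes m: "100 \<le> m" and s: "0 < s" "s \<le> \<tau>"
    and peak: "\<bar>x0\<bar> \<le> 1/16" "10 * m \<le> u x0 s"
    and small: "integral {-1/2..1/2} (\<lambda>x. bump x * excess1 m (u x s)) \<le> 1/10000"
  shows "integral {-1/2..1/2} (\<lambda>x. bump x * (excess1 m (u x s) * r x s)) \<le> - 11/10"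
proof -
  have m0: "0 < m"
    using m by simp
  have sI: "s \<in> {0..\<tau>}"
    using s by simp
  note int = integrable_slice[OF sI]
  let ?D = "\<lambda>x. bump x * (excess2 m (u x s) * p x s * arctan (p x s))"
  have influx: "integral {-1/2..1/2} (\<lambda>x. - (bump1 x * (excess1 m (u x s) * arctan (p x s)))) \<le> 16/100"
  proof -
    \<comment> \<open>\<open>\<epsilon> = 1/200\<close> balances the two parts of the bound on \<open>\<bar>bump1\<bar>\<close>: each contributes \<open>8/100\<close>.\<close>
    have "integral {-1/2..1/2} (\<lambda>x. - (bump1 x * (excess1 m (u x s) * arctan (p x s))))
        \<le> integral {-1/2..1/2} (\<lambda>x. 16/200 + 800 * (bump x * excess1 m (u x s)))"
    proof (intro integral_le integrable_neg integrable_add integrable_on_mult_right int m0)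
      fix x :: real assume x: "x \<in> {-1/2..1/2}"
      let ?e = "excess1 m (u x s)"
      have "\<bar>bump1 x\<bar> * ?e \<le> 8 * (1/200 + bump x / (4 * (1/200))) * ?e"
        using bump_bounds(3)[OF x, of "1/200"] excess1_bounds[OF m0]
        by (intro mult_right_mono) auto
      also have "\<dots> = 8/200 * ?e + 400 * (bump x * ?e)"
        by (simp add: algebra_simps)
      finally show "- (bump1 x * (?e * arctan (p x s))) \<le> 16/200 + 800 * (bump x * ?e)"
        using boundary_term_bound[OF m0, of x s] excess1_bounds(2)[OF m0, of "u x s"] by linarith
    qed auto
    also have "\<dots> = 16/200 + 800 * integral {-1/2..1/2} (\<lambda>x. bump x * excess1 m (u x s))"
      by (subst integral_add) (use int m0 in auto)
    finally show ?thesis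
      using small by linarith
  qed
  \<comment> \<open>The mass is too small for \<open>u\<close> to stay high on all of \<open>[x0, x0 + 1/16]\<close>.\<close>
  obtain y where y: "x0 \<le> y" "y \<le> x0 + 1/16" "excess1 m (u y s) \<le> 1/100"
  proof (rule ccontr)
    assume none: "\<not> thesis"
    note found = that
    have high: "1/100 < excess1 m (u x s)" if "x0 \<le> x" "x \<le> x0 + 1/16" for x
      using none found[OF that] by linarith
    let ?I = "{x0..x0 + 1/16}"
    have sub: "?I \<subseteq> {-1/2..1/2}"
      using peak by auto
    have on_I: "(\<lambda>x. bump x * excess1 m (u x s)) integrable_on ?I"
      by (rule integrable_on_subinterval[OF int(3)[OF m0] sub])
    have "(87/10000 / 16 :: real) = integral ?I (\<lambda>x. 87/100 * (1/100))"
      by simp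
    also have "\<dots> \<le> integral ?I (\<lambda>x. bump x * excess1 m (u x s))"
    proof (intro integral_le on_I mult_mono)
      fix x assume x: "x \<in> ?I"
      then show "87/100 \<le> bump x"
        using peak by (intro bump_central) auto
      show "1/100 \<le> excess1 m (u x s)"
        using high[of x] x by simp
      show "0 \<le> bump x"
        using x sub by (intro bump_bounds) auto
    qed auto
    also have "\<dots> \<le> integral {-1/2..1/2} (\<lambda>x. bump x * excess1 m (u x s))"
      using bump_bounds(1) excess1_bounds(1)[OF m0]
      by (intro integral_subset_le sub on_I int m0) auto
    finally show False
      using small by simp
  qed
  let ?Y = "{x0..y}"
  have subY: "?Y \<subseteq> {-1/2..1/2}"
    using peak y by auto
  have gain: "126/100 \<le> integral {-1/2..1/2} ?D"
  proof -
    let ?E = "\<lambda>x. - (1305/1000) * (excess2 m (u x s) * p x s) - 1 / m"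
    have "((\<lambda>x. excess2 m (u x s) * p x s) has_integral excess1 m (u y s) - excess1 m (u x0 s)) ?Y"
    proof (rule fundamental_theorem_of_calculus[OF y(1)])
      fix x assume "x \<in> ?Y"
      then have "x \<in> {-1<..<1}"
        using peak y by auto
      from DERIV_chain2[OF DERIV_excess1[OF m0] DERIV_u[OF this sI]]
      show "((\<lambda>x. excess1 m (u x s)) has_vector_derivative excess2 m (u x s) * p x s)
          (at x within ?Y)"
        using has_field_derivative_at_within has_real_derivative_iff_has_vector_derivative by blast
    qed
    from has_integral_diff[OF has_integral_mult_right[OF this, of "- (1305/1000)"]
        has_integral_const_real[of "1 / m" x0 y]] y(1)
    have E: "(?E has_integral
        - (1305/1000) * (excess1 m (u y s) - excess1 m (u x0 s)) - (y - x0) / m) ?Y"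
      by simp
    have "(y - x0) / m \<le> 1 / 100"
      using y m by (simp add: divide_simps)
    moreover have "126/100 \<le> - (1305/1000) * (B - A) - D"
      if "D \<le> 1/100" "B \<le> 1/100" "100/101 \<le> A" for A B D :: real
      using that by (simp add: field_simps)
    ultimately have "126/100 \<le> - (1305/1000) * (excess1 m (u y s) - excess1 m (u x0 s)) - (y - x0) / m"
      using y(3) excess1_large[OF m0 peak(2)] by blast
    also have "\<dots> = integral ?Y ?E"
      using E by (simp add: integral_unique)
    also have "\<dots> \<le> integral ?Y ?D"
    proof (rule integral_le)
      show "?E integrable_on ?Y"
        using E by blast
      show "?D integrable_on ?Y"
        by (rule integrable_on_subinterval[OF int(5)[OF m0] subY])
      fix x assume x: "x \<in> ?Y"
      let ?b = "bump x * excess2 m (u x s)"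
      have x': "x \<in> {-1/2..1/2}"
        using x subY by blast
      have b: "0 \<le> bump x" "bump x \<le> 1" "87/100 \<le> bump x"
        using bump_bounds[OF x'] bump_central[of x] x peak y by auto
      have e: "0 \<le> excess2 m (u x s)" "excess2 m (u x s) \<le> 1 / m"
        using excess2_bounds[OF m0] by auto
      have "3/2 * \<bar>p x s\<bar> \<le> pi / 2 * \<bar>p x s\<bar>"
        using pi_gt3 by (intro mult_right_mono) auto
      then have "3/2 * \<bar>p x s\<bar> - 1 \<le> p x s * arctan (p x s)"
        using mult_arctan_lower[of "p x s"] by linarith
      then have "?b * (3/2 * \<bar>p x s\<bar> - 1) \<le> ?b * (p x s * arctan (p x s))"
        using b e by (intro mult_left_mono) auto
      moreover have "bump x * excess2 m (u x s) \<le> 1 * (1 / m)"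
        using b e by (intro mult_mono) auto
      moreover have "87/100 * (excess2 m (u x s) * \<bar>p x s\<bar>) \<le> bump x * (excess2 m (u x s) * \<bar>p x s\<bar>)"
        using b e by (intro mult_right_mono) auto
      moreover have "- (excess2 m (u x s) * p x s) \<le> excess2 m (u x s) * \<bar>p x s\<bar>"
        using e mult_left_mono[of "- p x s" "\<bar>p x s\<bar>" "excess2 m (u x s)"] by simp
      ultimately show "?E x \<le> ?D x"
        by (simp add: algebra_simps)
    qed
    also have "\<dots> \<le> integral {-1/2..1/2} ?D"
      using bump_dissipation_nonneg[OF m0]
      by (intro integral_subset_le subY integrable_on_subinterval[OF int(5)[OF m0] subY] int m0) auto
    finally show ?thesis .
  qed
  show ?thesis
    using excess_mass_rate[OF m0 s] influx gain by simp
qed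

text \<open>
  If \<open>u 0 \<tau>\<close> were larger, the barrier would produce a peak of height \<open>10 * m\<close> at every time, and the
  excess mass would decrease at a rate greater than 1 throughout. Starting from at most \<open>\<tau>\<close>, it would
  be negative at time \<open>\<tau>\<close>. The factor 100000 in \<open>m\<close> makes \<open>m\<close> so large against the mass, which is
  at most \<open>17 * (1 + \<tau>)\<close>, that the influx stays small.
\<close>

proposition mass_bound_imp_height_bound:
  assumes "positive_mass 0 \<le> \<tau>"
  shows "u 0 \<tau> \<le> 1000032 * (1 + \<tau>)"
proof (rule ccontr)
  define m where "m = 100000 * (1 + \<tau>)"
  have m: "100 \<le> m" "0 < m"
    using duration by (auto simp: m_def)
  assume "\<not> ?thesis"
  then have high: "10 * m + 32 * \<tau> < u 0 \<tau>"
    using duration by (simp add: m_def)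
  have "excess_mass m \<tau> \<le> excess_mass m 0 + (- 11/10) * \<tau>"
  proof (rule linear_growth_bound[OF _ _ DERIV_excess_mass[OF m(2)]])
    fix s assume s: "0 < s" "s < \<tau>"
    have sI: "s \<in> {0..\<tau>}"
      using s by simp
    obtain x0 where x0: "\<bar>x0\<bar> \<le> 1/16" "10 * m \<le> u x0 s"
    proof (rule ccontr)
      assume none: "\<not> thesis"
      note peak = that
      have "u x s \<le> 10 * m" if "\<bar>x\<bar> \<le> 1/16" for x
        using none peak[OF that] by linarith
      then have "u 0 \<tau> \<le> 10 * m + pi / (2 * (1/16)) * (\<tau> - s)"
        using s by (intro grim_reaper_barrier) auto
      moreover have "pi / (2 * (1/16)) * (\<tau> - s) \<le> 32 * \<tau>"
        using pi_less_4 s by (intro mult_mono) auto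
      ultimately show False
        using high by simp
    qed
    have "integral {-1/2..1/2} (\<lambda>x. bump x * excess1 m (u x s))
        \<le> integral {-1/2..1/2} (\<lambda>x. bump x * max 0 (u x s) / (2 * m))"
    proof (intro integral_le integrable_on_divide integrable_slice sI m)
      fix x :: real assume "x \<in> {-1/2..1/2}"
      then show "bump x * excess1 m (u x s) \<le> bump x * max 0 (u x s) / (2 * m)"
        using mult_left_mono[OF excess1_bounds(3)[OF m(2), of "u x s"] bump_bounds(1)] by simp
    qed
    also have "\<dots> = positive_mass s / (2 * m)"
      by (simp add: positive_mass_def)
    also have "\<dots> \<le> 17 * (1 + \<tau>) / (2 * m)"
      using positive_mass_growth[OF sI] assms s m(2) by (intro divide_right_mono) auto
    also have "\<dots> \<le> 1/10000"
      using duration by (simp add: m_def divide_simps)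
    finally show "integral {-1/2..1/2} (\<lambda>x. bump x * (excess1 m (u x s) * r x s)) \<le> - 11/10"
      using excess_mass_decay[OF m(1) s(1) _ x0] s by simp
  qed (use duration in auto)
  moreover have "0 \<le> excess_mass m \<tau>" "excess_mass m 0 \<le> \<tau>"
    using excess_mass_le_positive_mass[OF m(2)] assms duration by fastforce+
  ultimately show False
    using duration by simp
qed

end

section \<open>From integrability of the initial data to a height bound\<close>

text \<open>
  Where \<open>z > k\<close>, \<open>z = z powr (1 - e) * z powr e\<close> and the first factor is at most \<open>k powr (1 - e)\<close>. The
  coefficient 1 here, whatever \<open>e\<close>, makes the final constant uniform: a constant factor would have
  to be absorbed in \<open>k\<close> and would appear to the power \<open>1 / (e - 1)\<close>.
\<close>

lemma positive_excess_le_powr: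
  fixes z k e :: real
  assumes "0 < k" "1 < e"
  shows "max 0 (z - k) \<le> k powr (1 - e) * \<bar>z\<bar> powr e"
proof (cases "z \<le> k")
  case False
  then have "z - k \<le> z powr (1 - e) * z powr e"
    using assms by (simp add: powr_add[symmetric])
  also have "\<dots> \<le> k powr (1 - e) * z powr e"
    using False assms by (intro mult_right_mono powr_mono2') auto
  finally show ?thesis
    using False assms by simp
qed auto

context classical_flow
begin

lemma classical_flow_minus: "classical_flow \<tau> (\<lambda>x s. - u x s) (\<lambda>x s. - p x s) (\<lambda>x s. - q x s) (\<lambda>x s. - r x s)"
proof
  show "0 < \<tau>"
    by (rule duration)
  show "continuous_on ({-1<..<1} \<times> {0..\<tau>}) (\<lambda>(x, s). - u x s)"
    "continuous_on ({-1<..<1} \<times> {0..\<tau>}) (\<lambda>(x, s). - p x s)"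
    "continuous_on ({-1<..<1} \<times> {0..\<tau>}) (\<lambda>(x, s). - r x s)"
    using continuous_u continuous_p continuous_r
    by (simp_all add: case_prod_unfold continuous_on_minus)
qed (auto intro!: DERIV_minus DERIV_u DERIV_p DERIV_time simp: flow)

lemma classical_flow_shift: "classical_flow \<tau> (\<lambda>x s. u x s - k) p q r"
proof
  show "continuous_on ({-1<..<1} \<times> {0..\<tau>}) (\<lambda>(x, s). u x s - k)"
    using continuous_on_diff[OF continuous_u continuous_on_const[of _ k]]
    by (simp add: case_prod_unfold)
  show "\<And>x s. x \<in> {-1<..<1} \<Longrightarrow> s \<in> {0..\<tau>} \<Longrightarrow>
      ((\<lambda>y. u y s - k) has_real_derivative p x s) (at x)"
    using DERIV_diff[OF DERIV_u DERIV_const[of k]] by simp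
  show "\<And>x s. x \<in> {-1<..<1} \<Longrightarrow> s \<in> {0..\<tau>} \<Longrightarrow>
      ((\<lambda>s. u x s - k) has_real_derivative r x s) (at s within {0..\<tau>})"
    using DERIV_diff[OF DERIV_time DERIV_const[of k]] by simp
qed (fact duration continuous_p continuous_r DERIV_p flow)+

text \<open>
  The level \<open>k\<close> is chosen so that the initial mass of \<open>u\<close> above it is at most the available time
  \<open>\<tau>\<close>; the height bound then applies to \<open>u - k\<close>.
\<close>

lemma Lp_height_bound:
  assumes e: "1 < e" and Lp: "Lp_on e {-1<..<1} (\<lambda>x. u x 0)"
  shows "u 0 \<tau> \<le> 1000033 * (1 + Lp_norm_on e {-1<..<1} (\<lambda>x. u x 0) powr (e / (e - 1))
      / \<tau> powr (1 / (e - 1)) + \<tau>)"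
proof -
  let ?f = "\<lambda>x. \<bar>u x 0\<bar> powr e"
  define I where "I = integral\<^sup>L (lebesgue_on {-1<..<1}) ?f"
  have "(?f has_integral I) {-1<..<1}"
    unfolding I_def using Lp
    by (intro has_integral_integral_lebesgue_on) (auto simp: Lp_on_def)
  then have f: "?f integrable_on {-1<..<1}" "integral {-1<..<1} ?f = I"
    by (auto simp: integral_unique)
  have "0 \<le> I"
    unfolding I_def by (intro integral_nonneg_AE) simp
  define k0 where "k0 = Lp_norm_on e {-1<..<1} (\<lambda>x. u x 0) powr (e / (e - 1)) / \<tau> powr (1 / (e - 1))"
  have k0: "k0 = I powr (1 / (e - 1)) / \<tau> powr (1 / (e - 1))"
    using e by (simp add: k0_def Lp_norm_on_def I_def powr_powr)
  have "0 \<le> k0"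
    by (simp add: k0)
  have "k0 powr (e - 1) = I / \<tau>"
    using e duration \<open>0 \<le> I\<close> by (simp add: k0 powr_divide powr_powr)
  then have I: "I = \<tau> * k0 powr (e - 1)"
    using duration by simp
  \<comment> \<open>Adding 1 keeps the level positive when \<open>I = 0\<close>.\<close>
  define k where "k = 1 + k0"
  have k: "0 < k"
    using \<open>0 \<le> k0\<close> by (simp add: k_def)
  interpret v: classical_flow \<tau> "\<lambda>x s. u x s - k" p q r
    by (rule classical_flow_shift)
  have sub: "{-1/2..1/2::real} \<subseteq> {-1<..<1}"
    by auto
  have fsub: "?f integrable_on {-1/2..1/2}"
    by (rule integrable_on_subinterval[OF f(1) sub])
  have "v.positive_mass 0 \<le> integral {-1/2..1/2} (\<lambda>x. k powr (1 - e) * ?f x)"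
    unfolding v.positive_mass_def
  proof (intro integral_le v.integrable_slice integrable_on_mult_right fsub)
    fix x :: real assume "x \<in> {-1/2..1/2}"
    then have "bump x * max 0 (u x 0 - k) \<le> 1 * max 0 (u x 0 - k)"
      using bump_bounds(2) by (intro mult_right_mono) auto
    also have "\<dots> \<le> k powr (1 - e) * ?f x"
      unfolding mult_1 by (rule positive_excess_le_powr[OF k e])
    finally show "bump x * max 0 (u x 0 - k) \<le> k powr (1 - e) * ?f x" .
  qed (use duration in simp)
  also have "\<dots> \<le> k powr (1 - e) * I"
    using integral_subset_le[OF sub fsub f(1)] f(2) by (simp add: mult_left_mono)
  also have "\<dots> \<le> k powr (1 - e) * (\<tau> * k powr (e - 1))"
    unfolding I using \<open>0 \<le> k0\<close> duration e
    by (intro mult_left_mono powr_mono2) (auto simp: k_def)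
  also have "\<dots> = \<tau>"
    using k by (simp add: powr_add[symmetric] mult.left_commute[of _ \<tau>])
  finally have "u 0 \<tau> - k \<le> 1000032 * (1 + \<tau>)"
    by (rule v.mass_bound_imp_height_bound)
  then show ?thesis
    unfolding k0_def[symmetric] using \<open>0 \<le> k0\<close> duration by (simp add: k_def)
qed

end

section \<open>Smooth solutions\<close>

lemma open_times_pos: "open (times_pos T)"
proof -
  have "open (ereal -` {..<T})"
    by (intro continuous_open_vimage) (auto intro!: continuous_intros)
  moreover have "times_pos T = {0<..} \<inter> ereal -` {..<T}"
    by (auto simp: times_pos_def)
  ultimately show ?thesis
    by (simp add: open_Int)
qed

text \<open>
  The equation holds for positive times, with the time derivative taken within \<open>(0,T)\<close>. At such
  times it agrees with the derivative within \<open>[0,T)\<close>, which is the one that is continuous up to the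
  initial time.
\<close>

lemma smooth_gcsf_imp_classical_flow:
  assumes smooth: "smooth_on {-1<..<1} (times_nonneg T) u"
    and gcsf: "gcsf {-1<..<1} T u"
    and t: "t \<in> times_pos T"
  shows "\<exists>p q r. classical_flow t u p q r"
proof -
  let ?J = "{-1<..<1::real}" and ?N = "times_nonneg T"
  let ?p = "deriv_x ?J u"
  let ?q = "deriv_x ?J ?p" and ?r = "deriv_t ?N u"
  have "Ck_on (Suc (Suc 0)) ?J ?N u"
    using smooth by (simp add: smooth_on_def)
  then have cont: "continuous_on (?J \<times> ?N) (\<lambda>(x, t). u x t)"
      "continuous_on (?J \<times> ?N) (\<lambda>(x, t). ?p x t)"
      "continuous_on (?J \<times> ?N) (\<lambda>(x, t). ?r x t)"
    and diff: "\<And>x s. x \<in> ?J \<Longrightarrow> s \<in> ?N \<Longrightarrow> (\<lambda>y. u y s) differentiable (at x within ?J)"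
      "\<And>x s. x \<in> ?J \<Longrightarrow> s \<in> ?N \<Longrightarrow> (\<lambda>y. ?p y s) differentiable (at x within ?J)"
      "\<And>x s. x \<in> ?J \<Longrightarrow> s \<in> ?N \<Longrightarrow> u x differentiable (at s within ?N)"
    by simp_all
  have sub: "{0..t} \<subseteq> ?N"
    using t le_less_trans[of "ereal _" "ereal t" T] by (auto simp: times_pos_def times_nonneg_def)
  have "classical_flow t u ?p ?q ?r"
  proof
    show "0 < t"
      using t by (simp add: times_pos_def)
    show "continuous_on (?J \<times> {0..t}) (\<lambda>(x, t). u x t)"
      "continuous_on (?J \<times> {0..t}) (\<lambda>(x, t). ?p x t)"
      "continuous_on (?J \<times> {0..t}) (\<lambda>(x, t). ?r x t)"
      using cont[THEN continuous_on_subset, of "?J \<times> {0..t}"] sub by auto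
    fix x s assume x: "x \<in> ?J"
    have at: "at x within ?J = at x"
      using x by (intro at_within_open) auto
    {
      assume "s \<in> {0..t}"
      then have s: "s \<in> ?N"
        using sub by blast
      show "((\<lambda>y. u y s) has_real_derivative ?p x s) (at x)"
        using vector_derivative_works[THEN iffD1, OF diff(1)[OF x s]]
        unfolding deriv_x_def has_real_derivative_iff_has_vector_derivative at .
      show "((\<lambda>y. ?p y s) has_real_derivative ?q x s) (at x)"
        using vector_derivative_works[THEN iffD1, OF diff(2)[OF x s]]
        unfolding deriv_x_def[of _ ?p] has_real_derivative_iff_has_vector_derivative at .
      have "(u x has_real_derivative ?r x s) (at s within ?N)"
        using vector_derivative_works[THEN iffD1, OF diff(3)[OF x s]]
        unfolding deriv_t_def has_real_derivative_iff_has_vector_derivative .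
      then show "(u x has_real_derivative ?r x s) (at s within {0..t})"
        by (rule DERIV_subset[OF _ sub])
    }
    assume "0 < s" "s \<le> t"
    then have s: "s \<in> times_pos T"
      using subsetD[OF sub, of s] by (simp add: times_pos_def times_nonneg_def)
    have "times_pos T \<subseteq> ?N"
      by (auto simp: times_pos_def times_nonneg_def)
    then have "s \<in> interior ?N"
      using s open_times_pos interior_maximal by blast
    then have "at s within ?N = at s within times_pos T"
      using at_within_interior[of s ?N] at_within_open[OF s open_times_pos] by simp
    then have "?r x s = deriv_t (times_pos T) u x s"
      by (simp add: deriv_t_def)
    then show "?r x s = ?q x s / (1 + (?p x s)\<^sup>2)"
      using gcsf x s by (simp add: gcsf_def)
  qed
  then show ?thesis
    by blast
qed

theorem theorem1p12:
  "\<exists>C::real. \<forall>(T::ereal) (p::real) (u::real \<Rightarrow> real \<Rightarrow> real).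
     0 < T \<longrightarrow> 1 < p \<longrightarrow>
     smooth_on {-1<..<1} (times_nonneg T) u \<longrightarrow>
     gcsf {-1<..<1} T u \<longrightarrow>
     Lp_on p {-1<..<1} (\<lambda>x. u x 0) \<longrightarrow>
     (\<forall>t\<in>times_pos T.
        \<bar>u 0 t\<bar> \<le> C * (1 + Lp_norm_on p {-1<..<1} (\<lambda>x. u x 0) powr (p / (p - 1))
                              / t powr (1 / (p - 1)) + t))"
proof (intro exI[of _ 1000033] allI impI ballI)
  fix T :: ereal and p :: real and u :: "real \<Rightarrow> real \<Rightarrow> real" and t :: real
  assume p: "1 < p"
    and "smooth_on {-1<..<1} (times_nonneg T) u" "gcsf {-1<..<1} T u" "t \<in> times_pos T"
    and Lp: "Lp_on p {-1<..<1} (\<lambda>x. u x 0)"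
  then obtain u' u'' v where "classical_flow t u u' u'' v"
    using smooth_gcsf_imp_classical_flow by blast
  then interpret classical_flow t u u' u'' v .
  interpret neg: classical_flow t "\<lambda>x s. - u x s" "\<lambda>x s. - u' x s" "\<lambda>x s. - u'' x s" "\<lambda>x s. - v x s"
    by (rule classical_flow_minus)
  have "Lp_on p {-1<..<1} (\<lambda>x. - u x 0)"
    using Lp by (simp add: Lp_on_def)
  then show "\<bar>u 0 t\<bar> \<le> 1000033 * (1 + Lp_norm_on p {-1<..<1} (\<lambda>x. u x 0) powr (p / (p - 1))
                              / t powr (1 / (p - 1)) + t)"
    using Lp_height_bound[OF p Lp] neg.Lp_height_bound[OF p]
    by (simp add: Lp_norm_on_def abs_le_iff)
qed

end
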